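(* Let $n\ge 2$ and let $S=\{a_1,\dots,a_n\}$ be a multiset of nonnegative integers with at least two indices $i$ such that $a_i>0$. Let $k$ be the maximum integer such that $2^k$ divides $a_i$ for every $i\in\{1,\dots,n\}$. Then there exist integers $t_1,\dots,t_n$ with $t_i\ge a_i$ for all $i\in\{1,\dots,n\}$ such that $$t_1\oplus t_2\oplus\cdots\oplus t_n=(t_1-a_1)\oplus(t_2-a_2)\oplus\cdots\oplus(t_n-a_n)=0$$ if and only if one of the following holds: (1) $n$ is odd and $S$ is balanced; (2) $n$ is even, and at least one of the following holds: (i) $S$ is balanced and there is $i\in\{1,\dots,n\}$ such that the bit $a_i^k$ in position $k$ of $a_i$ equals $0$; (ii) $S$ is smooth and $n\ge 4$; (iii) $S$ is even.
   Context: For nonnegative integers, $\oplus$ denotes nim-sum, i.e. bitwise exclusive-or of binary expansions (addition without carry). For a nonnegative integer $s$, write $s=\sum_{j\ge 0}s^j2^j$ with $s^j\in\{0,1\}$; $s^j$ is the bit in position $j$ of $s$ (the superscript is an index, not a power). Let $S=\{a_1,\dots,a_n\}$ be a multiset (the $a_i$ need not be distinct) of nonnegative integers, not all zero. Let $\sigma=a_1\oplus\cdots\oplus a_n$, and let $k$ be the maximum integer such that $2^k$ divides every $a_i$. $S$ is called balanced if $\sigma^k=0$; smooth if $\sigma^k=\sigma^{k+1}=0$; and even if $\sigma=0$. *)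

theory Defs
  imports Main "HOL-Library.Multiset"
begin

unbundle bit_operations_syntax

definition nim_sum :: "nat multiset \<Rightarrow> nat" where
  "nim_sum S = fold_mset (XOR) 0 S"

lemma nim_sum_empty [simp]: "nim_sum {#} = 0"
  by (simp add: nim_sum_def)

lemma nim_sum_add_mset [simp]: "nim_sum (add_mset x S) = x XOR nim_sum S"
proof -
  interpret comp_fun_commute "(XOR) :: nat \<Rightarrow> nat \<Rightarrow> nat"
    by standard (auto simp: fun_eq_iff ac_simps)
  show ?thesis
    by (simp add: nim_sum_def)
qed

(* The maximum exists, and the value is meaningful, only if some element of S is nonzero. *)
definition common_two_exponent :: "nat multiset \<Rightarrow> nat" where
  "common_two_exponent S = (GREATEST k. \<forall>x \<in># S. 2 ^ k dvd x)"

definition nim_balanced :: "nat multiset \<Rightarrow> bool" where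
  "nim_balanced S \<longleftrightarrow> \<not> bit (nim_sum S) (common_two_exponent S)"

definition nim_smooth :: "nat multiset \<Rightarrow> bool" where
  "nim_smooth S \<longleftrightarrow>
     \<not> bit (nim_sum S) (common_two_exponent S) \<and>
     \<not> bit (nim_sum S) (common_two_exponent S + 1)"

definition nim_even :: "nat multiset \<Rightarrow> bool" where
  "nim_even S \<longleftrightarrow> nim_sum S = 0"

lemma common_two_exponent_greatest:
  assumes "x \<in># S" "x \<noteq> 0"
  shows "(\<forall>y \<in># S. 2 ^ common_two_exponent S dvd y) \<and>
         (\<forall>j. (\<forall>y \<in># S. 2 ^ j dvd y) \<longrightarrow> j \<le> common_two_exponent S)"
proof -
  have bound: "j \<le> x" if "\<forall>y \<in># S. 2 ^ j dvd y" for j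
  proof -
    have "2 ^ j \<le> x"
      using that assms by (auto intro: dvd_imp_le)
    then show ?thesis
      using less_exp [of j] by linarith
  qed
  have "\<forall>y \<in># S. 2 ^ (0::nat) dvd y"
    by simp
  from GreatestI_nat [where P = "\<lambda>k. \<forall>y \<in># S. 2 ^ k dvd y", OF this bound]
    Greatest_le_nat [where P = "\<lambda>k. \<forall>y \<in># S. 2 ^ k dvd y", OF _ bound]
  show ?thesis
    unfolding common_two_exponent_def by blast
qed

end

theory Submission imports Defs begin

text \<open>
  Put \<open>b\<^sub>i = t\<^sub>i - a\<^sub>i\<close> and add \<open>a\<^sub>i + b\<^sub>i\<close> in binary from the lowest bit upwards.
  Let \<open>c\<^sub>i\<close> be the carry of row \<open>i\<close> into the current position, and let \<open>\<alpha>\<^sub>i\<close> and \<open>\<beta>\<^sub>i\<close> be the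
  bits of \<open>a\<^sub>i\<close> and \<open>b\<^sub>i\<close> there. Both nim-sums vanish iff, at every position, the \<open>\<beta>\<^sub>i\<close> have even sum
  and the \<open>\<alpha>\<^sub>i + c\<^sub>i\<close> have even sum. The next carry of a row with \<open>\<alpha>\<^sub>i = c\<^sub>i\<close> is \<open>c\<^sub>i\<close>, whatever
  \<open>\<beta>\<^sub>i\<close> is; the next carry of a row with \<open>\<alpha>\<^sub>i \<noteq> c\<^sub>i\<close> is \<open>\<beta>\<^sub>i\<close>. Hence, if rows of both kinds
  occur, the carries of the rows of the second kind can be chosen arbitrarily, since a row of the
  first kind absorbs the parity constraint on the \<open>\<beta>\<^sub>i\<close>.

  The key point is that such a mixed state can be kept for ever. By parity it has at least two
  rows of the second kind; one of them is used to give the next carries the right parity, and if the resulting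
  state is not mixed, flipping both makes it mixed while keeping the parity
  (\<open>ex_mixed_carries\<close>). Once the \<open>a\<^sub>i\<close> are exhausted, the remaining carries can
  be cleared. So every mixed state leads to a solution (\<open>mixed_completable\<close>).

  Nothing happens below position \<open>k\<close>. At position \<open>k\<close> all carries are \<open>0\<close>, which forces \<open>S\<close> to be
  balanced, and the state is mixed iff some \<open>a\<^sub>i\<close> has bit \<open>0\<close> there; this is automatic for a balanced
  \<open>S\<close> with \<open>n\<close> odd. If every \<open>a\<^sub>i\<close> has bit \<open>1\<close> there, the next carries are exactly the \<open>\<beta>\<^sub>i\<close>, of
  even sum, so \<open>S\<close> must be smooth; with at least three rows the \<open>\<beta>\<^sub>i\<close> can be chosen so that the next
  state is mixed. With \<open>n = 2\<close> both nim-sums vanish only if \<open>t\<^sub>1 = t\<^sub>2\<close> and \<open>b\<^sub>1 = b\<^sub>2\<close>, so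
  \<open>a\<^sub>1 = a\<^sub>2\<close>. Finally, if \<open>S\<close> is even then \<open>t = a\<close> is a solution.
\<close>

section \<open>Nim-sums of families, bit by bit\<close>

abbreviation nim_sum_on :: "'i set \<Rightarrow> ('i \<Rightarrow> nat) \<Rightarrow> nat" where
  "nim_sum_on I f \<equiv> nim_sum (image_mset f (mset_set I))"

lemma even_nim_sum_on:
  assumes "finite I"
  shows "even (nim_sum_on I f) \<longleftrightarrow> even (\<Sum>i\<in>I. f i)"
  using assms by (induction I rule: finite_induct) (simp_all add: even_xor_iff)

lemma nim_sum_on_div_two:
  assumes "finite I"
  shows "nim_sum_on I f div 2 = nim_sum_on I (\<lambda>i. f i div 2)"
proof -
  have "(x XOR y) div 2 = (x div 2) XOR (y div 2)" for x y :: nat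
    using drop_bit_xor [of 1 x y] by (simp add: drop_bit_eq_div)
  with assms show ?thesis
    by (induction I rule: finite_induct) simp_all
qed

lemma nim_sum_on_eq_0_iff:
  assumes "finite I"
  shows "nim_sum_on I f = 0 \<longleftrightarrow> even (\<Sum>i\<in>I. f i) \<and> nim_sum_on I (\<lambda>i. f i div 2) = 0"
proof -
  have "x = 0 \<longleftrightarrow> even x \<and> x div 2 = 0" for x :: nat by presburger
  then show ?thesis
    unfolding even_nim_sum_on [OF assms, symmetric] nim_sum_on_div_two [OF assms, symmetric] .
qed

lemma bit_nim_sum_on:
  assumes "finite I"
  shows "bit (nim_sum_on I f) j \<longleftrightarrow> odd (\<Sum>i\<in>I. f i div 2 ^ j)"
proof (induction j arbitrary: f)
  case 0
  then show ?case by (simp add: bit_0 even_nim_sum_on [OF assms])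
next
  case (Suc j)
  then show ?case
    by (simp add: bit_Suc nim_sum_on_div_two [OF assms] div_mult2_eq)
qed

lemma nim_sum_on_mult_power_two:
  assumes "finite I" and "nim_sum_on I f = 0"
  shows "nim_sum_on I (\<lambda>i. 2 ^ k * f i) = 0"
proof (induction k)
  case (Suc k)
  then show ?case
    using assms(1)
    by (subst nim_sum_on_eq_0_iff)
      (simp_all add: mult.assoc flip: sum_distrib_left)
qed (use assms in simp)

lemma nim_sum_on_zero:
  assumes "finite I"
  shows "nim_sum_on I (\<lambda>i. 0) = 0"
  using assms by (induction I rule: finite_induct) simp_all

lemma odd_sum_imp_ex_odd:
  fixes f :: "'i \<Rightarrow> nat"
  assumes "odd (\<Sum>i\<in>I. f i)"
  shows "\<exists>i\<in>I. odd (f i)"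
  using assms by (meson dvd_sum)

section \<open>The carry process\<close>

text \<open>
  The state of the binary addition: \<open>a\<close> is what remains of the given numbers from the current
  position upwards and \<open>c\<close> holds the incoming carries.
\<close>

definition completable :: "'i set \<Rightarrow> ('i \<Rightarrow> nat) \<Rightarrow> ('i \<Rightarrow> nat) \<Rightarrow> bool" where
  "completable I a c \<longleftrightarrow>
     (\<exists>b. nim_sum_on I b = 0 \<and> nim_sum_on I (\<lambda>i. a i + b i + c i) = 0)"

text \<open>
  For \<open>c i \<in> {0, 1}\<close>, \<open>a i + c i\<close> is even iff the carry equals the lowest bit of \<open>a i\<close>, that is, iff
  the outgoing carry does not depend on the bit chosen for \<open>b i\<close>.
\<close>

definition mixed :: "'i set \<Rightarrow> ('i \<Rightarrow> nat) \<Rightarrow> ('i \<Rightarrow> nat) \<Rightarrow> bool" where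
  "mixed I a c \<longleftrightarrow> (\<forall>i\<in>I. c i \<le> 1) \<and> even (\<Sum>i\<in>I. a i + c i) \<and>
     (\<exists>i\<in>I. even (a i + c i)) \<and> (\<exists>i\<in>I. odd (a i + c i))"

text \<open>One position of the addition, with lowest bits \<open>\<beta>\<close> of the summand to be found.\<close>

lemma completable_step:
  assumes "finite I"
    and "even (\<Sum>i\<in>I. a i + c i)"
    and \<beta>: "\<forall>i\<in>I. \<beta> i \<le> 1" "even (\<Sum>i\<in>I. \<beta> i)"
    and c': "\<forall>i\<in>I. c' i = (a i mod 2 + \<beta> i + c i) div 2"
    and "completable I (\<lambda>i. a i div 2) c'"
  shows "completable I a c"
proof -
  obtain b where b: "nim_sum_on I b = 0" "nim_sum_on I (\<lambda>i. a i div 2 + b i + c' i) = 0"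
    using assms(6) unfolding completable_def by blast
  define b' where "b' = (\<lambda>i. 2 * b i + \<beta> i)"
  have "image_mset (\<lambda>i. b' i div 2) (mset_set I) = image_mset b (mset_set I)"
    using \<beta>(1) assms(1) by (intro image_mset_cong) (force simp: b'_def)
  moreover have "even (\<Sum>i\<in>I. b' i)"
    using \<beta>(2) by (simp add: b'_def sum.distrib flip: sum_distrib_left)
  ultimately have *: "nim_sum_on I b' = 0"
    using b(1) by (subst nim_sum_on_eq_0_iff [OF assms(1)]) simp
  have "(a i + b' i + c i) div 2 = a i div 2 + b i + c' i" if "i \<in> I" for i
  proof -
    have "c' i = (a i mod 2 + \<beta> i + c i) div 2" using c' that by blast
    then show ?thesis unfolding b'_def by presburger
  qed
  then have "image_mset (\<lambda>i. (a i + b' i + c i) div 2) (mset_set I)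
      = image_mset (\<lambda>i. a i div 2 + b i + c' i) (mset_set I)"
    using assms(1) by (intro image_mset_cong) simp
  moreover have "(\<Sum>i\<in>I. a i + b' i + c i) = (\<Sum>i\<in>I. a i + c i) + (\<Sum>i\<in>I. b' i)"
    by (simp add: sum.distrib)
  then have "even (\<Sum>i\<in>I. a i + b' i + c i)"
    using assms(2) \<open>even (\<Sum>i\<in>I. b' i)\<close> by simp
  ultimately have "nim_sum_on I (\<lambda>i. a i + b' i + c i) = 0"
    using b(2) by (subst nim_sum_on_eq_0_iff [OF assms(1)]) simp
  with * show ?thesis
    unfolding completable_def by blast
qed

text \<open>
  Flipping the carries of the rows \<open>q\<close> and \<open>r\<close> keeps the parity of their sum. If all rows were of the
  same kind before, then \<open>q\<close> is of the other kind afterwards while \<open>p\<close> keeps its kind.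
\<close>

lemma ex_mixed_carries:
  assumes "finite I" and "p \<in> I" "q \<in> I" "r \<in> I" "p \<noteq> q" "p \<noteq> r" "q \<noteq> r"
    and u: "\<forall>i\<in>I. u i \<le> 1" "even (\<Sum>i\<in>I. a i + u i)"
  shows "\<exists>c. mixed I a c \<and> (\<forall>i. i \<noteq> q \<and> i \<noteq> r \<longrightarrow> c i = u i)
           \<and> even ((\<Sum>i\<in>I. c i) + (\<Sum>i\<in>I. u i))"
proof (cases "mixed I a u")
  case True
  then show ?thesis by (metis even_add)
next
  case False
  define c where "c = u(q := 1 - u q, r := 1 - u r)"
  have split: "(\<Sum>i\<in>I. f i) = f q + (f r + (\<Sum>i\<in>I - {q} - {r}. f i))" for f :: "'a \<Rightarrow> nat"
    using assms by (simp add: sum.remove [of I q] sum.remove [of "I - {q}" r])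
  have rest: "(\<Sum>i\<in>I - {q} - {r}. c i) = (\<Sum>i\<in>I - {q} - {r}. u i)"
    by (intro sum.cong) (auto simp: c_def)
  have bound: "u q \<le> 1" "u r \<le> 1" using u(1) assms by auto
  have "(\<Sum>i\<in>I. c i) + (\<Sum>i\<in>I. u i) = 2 + 2 * (\<Sum>i\<in>I - {q} - {r}. u i)"
    unfolding split [of c] split [of u] rest using bound \<open>q \<noteq> r\<close> by (simp add: c_def)
  then have parity: "even ((\<Sum>i\<in>I. c i) + (\<Sum>i\<in>I. u i))" by simp
  then have even: "even (\<Sum>i\<in>I. a i + c i)"
    using u(2) by (simp add: sum.distrib)
  have "even (a p + c p) \<noteq> even (a q + c q)"
  proof -
    have "even (a p + u p) = even (a q + u q)"
      using False u assms(2,3) unfolding mixed_def by blast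
    moreover have "c p = u p" "c q = 1 - u q" using assms by (auto simp: c_def)
    ultimately show ?thesis using bound(1) by (cases "u q = 0") auto
  qed
  moreover have "\<forall>i\<in>I. c i \<le> 1" using u(1) by (simp add: c_def)
  ultimately have "mixed I a c"
    using even assms(2,3) unfolding mixed_def by blast
  moreover have "\<forall>i. i \<noteq> q \<and> i \<noteq> r \<longrightarrow> c i = u i" by (simp add: c_def)
  ultimately show ?thesis using parity by blast
qed

lemma mixed_step:
  assumes "finite I" and "mixed I a c"
    and IH: "\<And>c'. mixed I (\<lambda>i. a i div 2) c' \<Longrightarrow> completable I (\<lambda>i. a i div 2) c'"
  shows "completable I a c"
proof -
  obtain p q where pq: "p \<in> I" "q \<in> I" "even (a p + c p)" "odd (a q + c q)"
    using assms(2) unfolding mixed_def by blast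
  have c: "\<forall>i\<in>I. c i \<le> 1" and even: "even (\<Sum>i\<in>I. a i + c i)"
    using assms(2) unfolding mixed_def by auto
  have "odd (\<Sum>i\<in>I - {q}. a i + c i)"
    using even pq assms(1) by (simp add: sum.remove [of I q])
  then obtain r where r: "r \<in> I" "r \<noteq> q" "odd (a r + c r)"
    using odd_sum_imp_ex_odd by blast
  have distinct: "p \<noteq> q" "p \<noteq> r" "q \<noteq> r" using pq r by auto
  \<comment> \<open>The carry of row \<open>q\<close> can be chosen freely and is used to correct the parity.\<close>
  define s where "s = (\<Sum>i\<in>I - {q}. a i div 2 + c i)"
  define u where "u = c(q := (a q div 2 + s) mod 2)"
  have "(\<Sum>i\<in>I - {q}. a i div 2 + u i) = s"
    unfolding s_def by (intro sum.cong) (auto simp: u_def)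
  then have "(\<Sum>i\<in>I. a i div 2 + u i) = a q div 2 + (a q div 2 + s) mod 2 + s"
    using pq assms(1) by (simp add: sum.remove [of I q] u_def)
  then have "even (\<Sum>i\<in>I. a i div 2 + u i)" by presburger
  moreover have "\<forall>i\<in>I. u i \<le> 1" using c by (auto simp: u_def)
  ultimately obtain c' where c': "mixed I (\<lambda>i. a i div 2) c'"
      and off: "\<forall>i. i \<noteq> q \<and> i \<noteq> r \<longrightarrow> c' i = u i"
    using ex_mixed_carries [OF assms(1) \<open>p \<in> I\<close> \<open>q \<in> I\<close> \<open>r \<in> I\<close> distinct, of u "\<lambda>i. a i div 2"]
    by blast
  have c'_le: "\<forall>i\<in>I. c' i \<le> 1" using c' by (simp add: mixed_def)
  have same: "c' i = c i" if "even (a i + c i)" for i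
    using that off pq r by (auto simp: u_def)
  \<comment> \<open>The bit chosen in row \<open>p\<close> does not influence the carries and makes the sum of all bits even.\<close>
  define z where "z = (\<Sum>i\<in>I - {p}. c' i)"
  define \<beta> where "\<beta> = c'(p := z mod 2)"
  have "(\<Sum>i\<in>I - {p}. \<beta> i) = z"
    unfolding z_def by (intro sum.cong) (auto simp: \<beta>_def)
  then have "(\<Sum>i\<in>I. \<beta> i) = z mod 2 + z"
    using pq assms(1) by (simp add: sum.remove [of I p] \<beta>_def)
  then have "even (\<Sum>i\<in>I. \<beta> i)" by presburger
  moreover have "\<forall>i\<in>I. \<beta> i \<le> 1" using c'_le by (auto simp: \<beta>_def)
  moreover have "c' i = (a i mod 2 + \<beta> i + c i) div 2" if i: "i \<in> I" for i
  proof (cases "even (a i + c i)")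
    case True
    moreover have "c i \<le> 1" using c i by blast
    ultimately have "c i = a i mod 2" by presburger
    moreover have "\<beta> i \<le> 1" using \<open>\<forall>i\<in>I. \<beta> i \<le> 1\<close> i by blast
    ultimately show ?thesis using same [OF True] by simp
  next
    case False
    have "c i \<le> 1" using c i by blast
    with False have "a i mod 2 + c i = 1" by presburger
    moreover have "\<beta> i = c' i" using False pq by (auto simp: \<beta>_def)
    moreover have "c' i \<le> 1" using c'_le i by blast
    ultimately show ?thesis by presburger
  qed
  ultimately show ?thesis
    using completable_step [OF assms(1) even, of \<beta> c'] IH [OF c'] by blast
qed

theorem mixed_completable:
  assumes "finite I" and "mixed I a c"
  shows "completable I a c"
proof -
  have "completable I a c" if "\<forall>i\<in>I. a i < 2 ^ N" "mixed I a c" for N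
    using that
  proof (induction N arbitrary: a c)
    case 0
    then have a: "\<forall>i\<in>I. a i = 0" by simp
    \<comment> \<open>Adding the carries to themselves moves them up one position, so their nim-sum stays zero.\<close>
    have "even (\<Sum>i\<in>I. c i)" and c: "\<forall>i\<in>I. c i \<le> 1"
      using 0 a by (simp_all add: mixed_def)
    moreover have "image_mset (\<lambda>i. c i div 2) (mset_set I) = image_mset (\<lambda>i. 0) (mset_set I)"
      using c assms(1) by (intro image_mset_cong) force
    ultimately have "nim_sum_on I c = 0"
      using nim_sum_on_zero [OF assms(1)] by (subst nim_sum_on_eq_0_iff [OF assms(1)]) simp
    moreover have "image_mset (\<lambda>i. a i + c i + c i) (mset_set I)
        = image_mset (\<lambda>i. 2 ^ 1 * c i) (mset_set I)"
      using a assms(1) by (intro image_mset_cong) simp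
    ultimately show ?case
      unfolding completable_def
      using nim_sum_on_mult_power_two [OF assms(1), of c 1] by metis
  next
    case (Suc N)
    have "\<forall>i\<in>I. a i div 2 < 2 ^ N" using Suc.prems(1) by auto
    then show ?case
      using mixed_step [OF assms(1) Suc.prems(2)] Suc.IH [of "\<lambda>i. a i div 2"] by blast
  qed
  moreover have "\<exists>N. \<forall>i\<in>I. a i < 2 ^ N"
  proof -
    have "a i < 2 ^ (\<Sum>i\<in>I. a i)" if "i \<in> I" for i
    proof -
      have "a i \<le> (\<Sum>i\<in>I. a i)" using assms(1) that by (simp add: member_le_sum)
      also have "\<dots> < 2 ^ (\<Sum>i\<in>I. a i)" by (rule less_exp)
      finally show ?thesis .
    qed
    then show ?thesis by blast
  qed
  ultimately show ?thesis using assms(2) by blast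
qed

text \<open>
  When all rows are odd, the outgoing carries are the chosen bits themselves. Three rows suffice to
  choose bits of even sum that lead to a mixed state.
\<close>

lemma all_odd_completable:
  assumes "finite I" and "card I \<ge> 3" and "even (card I)"
    and odd: "\<forall>i\<in>I. odd (a i)" and half: "even (\<Sum>i\<in>I. a i div 2)"
  shows "completable I a (\<lambda>i. 0)"
proof -
  obtain T where "T \<subseteq> I" "card T = 3"
    using assms(2) obtain_subset_with_card_n by metis
  then obtain p q r where pqr: "p \<in> I" "q \<in> I" "r \<in> I" "p \<noteq> q" "p \<noteq> r" "q \<noteq> r"
    by (auto simp: card_3_iff)
  obtain c' where c': "mixed I (\<lambda>i. a i div 2) c'" "even (\<Sum>i\<in>I. c' i)"
    using ex_mixed_carries [OF assms(1) pqr, of "\<lambda>i. 0" "\<lambda>i. a i div 2"] half by auto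
  have "even (\<Sum>i\<in>I. a i)"
    using even_sum_iff [OF assms(1), of a] odd assms(3) by (simp cong: conj_cong)
  moreover have le: "\<forall>i\<in>I. c' i \<le> 1" using c'(1) by (simp add: mixed_def)
  moreover have "c' i = (a i mod 2 + c' i + 0) div 2" if "i \<in> I" for i
  proof -
    have "a i mod 2 = 1" "c' i \<le> 1" using odd le that by (auto simp: odd_iff_mod_2_eq_one)
    then show ?thesis by presburger
  qed
  ultimately show ?thesis
    using completable_step [OF assms(1), of a "\<lambda>i. 0" c' c'] c'
      mixed_completable [OF assms(1) c'(1)] by simp
qed

section \<open>Reduction to the lowest relevant position\<close>

text \<open>The carry produced by adding \<open>y\<close> to an odd number is the lowest bit of \<open>y\<close>.\<close>

lemma half_add_odd:
  fixes x y :: nat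
  assumes "odd x"
  shows "(x + y) div 2 + y div 2 = x div 2 + y"
  using assms by (elim oddE, cases "even y") (auto elim!: oddE evenE)

lemma completable_imp_ex_summands:
  assumes "finite I" and "\<forall>i\<in>I. a i = 2 ^ k * a' i" and "completable I a' (\<lambda>i. 0)"
  shows "\<exists>t. (\<forall>i\<in>I. t i \<ge> a i) \<and> nim_sum_on I t = 0 \<and> nim_sum_on I (\<lambda>i. t i - a i) = 0"
proof -
  obtain b where b: "nim_sum_on I b = 0" "nim_sum_on I (\<lambda>i. a' i + b i) = 0"
    using assms(3) unfolding completable_def by auto
  define t where "t = (\<lambda>i. 2 ^ k * (a' i + b i))"
  have "image_mset (\<lambda>i. t i - a i) (mset_set I) = image_mset (\<lambda>i. 2 ^ k * b i) (mset_set I)"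
    using assms(1,2) by (intro image_mset_cong) (simp add: t_def distrib_left)
  then have "nim_sum_on I (\<lambda>i. t i - a i) = 0"
    using nim_sum_on_mult_power_two [OF assms(1) b(1)] by metis
  moreover have "nim_sum_on I t = 0"
    unfolding t_def using nim_sum_on_mult_power_two [OF assms(1) b(2)] .
  moreover have "\<forall>i\<in>I. t i \<ge> a i"
    using assms(2) by (simp add: t_def)
  ultimately show ?thesis by blast
qed

text \<open>
  Since \<open>a i\<close> has no bits below position \<open>k\<close>, no carry enters that position, and the bits there add
  up without interaction. If all bits of the \<open>a i\<close> there are \<open>1\<close>, the carries leaving that position
  are the bits of \<open>t i - a i\<close>, which have even sum.
\<close>

lemma summands_imp_parity:
  assumes "finite I" and "\<forall>i\<in>I. a i = 2 ^ k * a' i"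
    and t: "\<forall>i\<in>I. t i \<ge> a i" "nim_sum_on I t = 0" "nim_sum_on I (\<lambda>i. t i - a i) = 0"
  shows "even (\<Sum>i\<in>I. a' i)"
    and "\<forall>i\<in>I. odd (a' i) \<Longrightarrow> even (\<Sum>i\<in>I. a' i div 2)"
proof -
  define B where "B = (\<lambda>i. (t i - a i) div 2 ^ k)"
  have ev: "even (\<Sum>i\<in>I. t i div 2 ^ j)" "even (\<Sum>i\<in>I. (t i - a i) div 2 ^ j)" for j
    using bit_nim_sum_on [OF assms(1), of t j]
      bit_nim_sum_on [OF assms(1), of "\<lambda>i. t i - a i" j] t by simp_all
  have T: "t i div 2 ^ k = a' i + B i" if "i \<in> I" for i
  proof -
    have "t i = (t i - a i) + 2 ^ k * a' i" using t(1) assms(2) that by fastforce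
    then have "t i div 2 ^ k = ((t i - a i) + 2 ^ k * a' i) div 2 ^ k" by simp
    also have "\<dots> = a' i + B i" by (simp add: B_def)
    finally show ?thesis .
  qed
  have "even (\<Sum>i\<in>I. a' i + B i)"
    using ev(1) [of k] T by simp
  moreover have B: "even (\<Sum>i\<in>I. B i)"
    using ev(2) [of k] by (simp add: B_def)
  ultimately show "even (\<Sum>i\<in>I. a' i)" by (simp add: sum.distrib)
  assume odd: "\<forall>i\<in>I. odd (a' i)"
  \<comment> \<open>Both nim-sums have bit \<open>0\<close> at position \<open>k + 1\<close>; adding the two parities isolates the halves of
    the \<open>a' i\<close>.\<close>
  have "t i div 2 ^ Suc k + (t i - a i) div 2 ^ Suc k = a' i div 2 + B i"
    if "i \<in> I" for i
  proof -
    have "t i div 2 ^ Suc k = (a' i + B i) div 2"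
      using T [OF that] by (metis div_mult2_eq power_Suc2)
    moreover have "(t i - a i) div 2 ^ Suc k = B i div 2"
      unfolding B_def by (metis div_mult2_eq power_Suc2)
    moreover have "odd (a' i)" using odd that by blast
    ultimately show ?thesis by (simp add: half_add_odd)
  qed
  then have "(\<Sum>i\<in>I. t i div 2 ^ Suc k) + (\<Sum>i\<in>I. (t i - a i) div 2 ^ Suc k)
      = (\<Sum>i\<in>I. a' i div 2) + (\<Sum>i\<in>I. B i)"
    by (simp flip: sum.distrib)
  moreover have "even ((\<Sum>i\<in>I. t i div 2 ^ Suc k) + (\<Sum>i\<in>I. (t i - a i) div 2 ^ Suc k))"
    using ev [of "Suc k"] by simp
  ultimately show "even (\<Sum>i\<in>I. a' i div 2)"
    using B by (metis even_add)
qed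

section \<open>The characterisation\<close>

theorem theorem2:
  fixes n :: nat and a :: "nat \<Rightarrow> nat" and S :: "nat multiset" and k :: nat
  assumes "n \<ge> 2"
    and "S = {# a i. i \<in># mset_set {1..n} #}"
    and "card {i \<in> {1..n}. a i > 0} \<ge> 2"
    and "k = common_two_exponent S"
  shows
    "(\<exists>t :: nat \<Rightarrow> nat.
        (\<forall>i \<in> {1..n}. t i \<ge> a i) \<and>
        nim_sum {# t i. i \<in># mset_set {1..n} #} = 0 \<and>
        nim_sum {# t i - a i. i \<in># mset_set {1..n} #} = 0)
     \<longleftrightarrow>
     (odd n \<and> nim_balanced S) \<or>
     (even n \<and>
       ((nim_balanced S \<and> (\<exists>i \<in> {1..n}. \<not> bit (a i) k)) \<or>
        (nim_smooth S \<and> n \<ge> 4) \<or>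
        nim_even S))"
    (is "?solvable \<longleftrightarrow> ?condition")
proof -
  let ?I = "{1..n}"
  have fin: "finite ?I" by simp
  define a' where "a' = (\<lambda>i. a i div 2 ^ k)"
  have "{i \<in> ?I. a i > 0} \<noteq> {}"
  proof
    assume "{i \<in> ?I. a i > 0} = {}"
    with assms(3) show False by (simp only: card.empty)
  qed
  then obtain m where m: "m \<in> ?I" "a m \<noteq> 0" by auto
  have elems: "(\<forall>x\<in>#S. P x) \<longleftrightarrow> (\<forall>i\<in>?I. P (a i))" for P
    by (simp add: assms(2))
  have "a m \<in># S" using m by (simp add: assms(2))
  from common_two_exponent_greatest [OF this m(2)]
  have dvd: "\<forall>i\<in>?I. 2 ^ k dvd a i"
    and greatest: "\<And>j. \<forall>i\<in>?I. 2 ^ j dvd a i \<Longrightarrow> j \<le> k"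
    unfolding elems assms(4) [symmetric] by auto
  have a: "\<forall>i\<in>?I. a i = 2 ^ k * a' i"
    using dvd by (simp add: a'_def)
  have ex_odd: "\<exists>i\<in>?I. odd (a' i)"
  proof (rule ccontr)
    assume "\<not> ?thesis"
    then have "2 ^ Suc k dvd a i" if "i \<in> ?I" for i
      using a that by (metis mult_dvd_mono dvd_refl power_Suc2)
    with greatest [of "Suc k"] show False by auto
  qed
  have balanced: "nim_balanced S \<longleftrightarrow> even (\<Sum>i\<in>?I. a' i)"
    unfolding nim_balanced_def assms(4) [symmetric] unfolding assms(2) bit_nim_sum_on [OF fin]
    by (simp add: a'_def)
  have smooth: "nim_smooth S \<longleftrightarrow> even (\<Sum>i\<in>?I. a' i) \<and> even (\<Sum>i\<in>?I. a' i div 2)"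
    unfolding nim_smooth_def assms(4) [symmetric] unfolding assms(2) bit_nim_sum_on [OF fin]
    by (simp add: a'_def flip: div_mult2_eq power_Suc2)
  have bit: "bit (a i) k \<longleftrightarrow> odd (a' i)" for i
    by (simp add: bit_iff_odd a'_def)
  have all_odd: "even (\<Sum>i\<in>?I. a' i) \<longleftrightarrow> even n" if "\<forall>i\<in>?I. odd (a' i)"
  proof -
    have "{i \<in> ?I. odd (a' i)} = ?I" using that by auto
    then show ?thesis using even_sum_iff [OF fin, of a'] by simp
  qed
  show ?thesis
  proof
    assume ?solvable
    then obtain t where t: "\<forall>i\<in>?I. t i \<ge> a i" "nim_sum_on ?I t = 0"
        "nim_sum_on ?I (\<lambda>i. t i - a i) = 0"
      by blast
    note parity = summands_imp_parity [OF fin a t]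
    have "nim_smooth S" if "\<forall>i\<in>?I. bit (a i) k"
      using parity that unfolding smooth bit by blast
    moreover have "nim_even S" if "n = 2"
    proof -
      have I: "?I = {1, 2}" using that by auto
      have xor: "x = y" if "x XOR y = 0" for x y :: nat
        using that by (metis xor.assoc xor_self_eq xor.left_neutral xor.right_neutral)
      have "t 1 = t 2" "t 1 - a 1 = t 2 - a 2"
        using t(2,3) unfolding I by (auto intro: xor)
      moreover have "t 1 \<ge> a 1" "t 2 \<ge> a 2" using t(1) unfolding I by auto
      ultimately have "a 1 = a 2" by linarith
      then show ?thesis unfolding nim_even_def assms(2) I by simp
    qed
    moreover have "nim_balanced S"
      using parity(1) balanced by blast
    moreover have "n = 2 \<or> odd n \<or> n \<ge> 4"
      using assms(1) by presburger
    ultimately show ?condition by blast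
  next
    assume cond: ?condition
    have from_mixed: ?solvable if "nim_balanced S" "\<exists>i\<in>?I. even (a' i)"
    proof -
      have "mixed ?I a' (\<lambda>i. 0)"
        using that ex_odd unfolding mixed_def balanced by simp
      then show ?thesis
        using completable_imp_ex_summands [OF fin a] mixed_completable [OF fin] by blast
    qed
    consider "nim_balanced S" "\<exists>i\<in>?I. even (a' i)"
      | "even n" "nim_smooth S" "n \<ge> 4" "\<forall>i\<in>?I. odd (a' i)"
      | "nim_even S"
      using cond all_odd unfolding bit balanced smooth by blast
    then show ?solvable
    proof cases
      case 1
      then show ?thesis by (rule from_mixed)
    next
      case 2
      have "card ?I = n" by simp
      moreover from \<open>nim_smooth S\<close> have "even (\<Sum>i\<in>?I. a' i div 2)"
        unfolding smooth ..
      ultimately have "completable ?I a' (\<lambda>i. 0)"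
        using all_odd_completable [OF fin _ _ 2(4)] 2(1,3) by simp
      then show ?thesis by (rule completable_imp_ex_summands [OF fin a])
    next
      case 3
      then show ?thesis
        using nim_sum_on_zero [OF fin] unfolding nim_even_def assms(2) by (intro exI [of _ a]) simp
    qed
  qed
qed

end
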